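(* Let $X$ be a finite simplicial complex on vertex set $V$ with $|V|=n$, and suppose $h(X)=d$, i.e. the maximal dimension of a missing face of $X$ is $d$. Then for every integer $k\ge d$, $$(k-d+1)\,\mu_k(X)\ \ge\ (k+1)\,\mu_{k-1}(X)-dn .$$
   Context: A finite simplicial complex $X$ on a finite vertex set $V$ is a downward closed family of subsets of $V$ containing $\emptyset$ and every singleton $\{v\}$, $v\in V$; the dimension of a set $\sigma$ is $|\sigma|-1$, and $X(k)$ denotes the set of $k$-dimensional simplices of $X$. A set $\sigma\subset V$ is a missing face of $X$ if $\sigma\notin X$ but every proper subset of $\sigma$ belongs to $X$. $h(X)$ is the maximum of $\dim(\sigma)$ over all missing faces $\sigma$ of $X$ (so saying $h(X)=d$ presupposes that $X$ has a missing face, and $d\ge 1$). For $k\ge 0$, $C^k(X)$ is the real vector space of skew-symmetric real functions on ordered $k$-simplices of $X$, and $C^{-1}(X)=\mathbb{R}$. The coboundary $d_k:C^k(X)\to C^{k+1}(X)$ is $d_k\phi([v_0,\dots,v_{k+1}])=\sum_{i=0}^{k+1}(-1)^i\phi([v_0,\dots,\widehat{v_i},\dots,v_{k+1}])$ for $k\ge0$, and $(d_{-1}a)(v)=a$ for $a\in\mathbb{R}$, $v\in V$. $C^k(X)$ carries the inner product $\langle\phi,\psi\rangle=\sum_{\sigma\in X(k)}\phi(\sigma)\psi(\sigma)$ (one fixed ordering chosen for each simplex; on $C^{-1}(X)=\mathbb R$ the usual product), and $d_k^*$ is the adjoint of $d_k$. For $k\ge 0$ the reduced $k$-Laplacian is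 $L_k(X)=d_{k-1}d_{k-1}^*+d_k^*d_k:C^k(X)\to C^k(X)$, a positive semidefinite operator, and $\mu_k(X)$ is its smallest eigenvalue (with the convention $\mu_k(X)=+\infty$ if $X(k)=\emptyset$). *)

theory Defs
  imports Complex_Main "HOL-Library.Extended_Real" "HOL-Combinatorics.Combinatorics"
begin

definition abstract_simplicial_complex :: "'a set \<Rightarrow> 'a set set \<Rightarrow> bool" where
  "abstract_simplicial_complex V X \<longleftrightarrow>
     finite V \<and> X \<subseteq> Pow V \<and> {} \<in> X \<and> (\<forall>v\<in>V. {v} \<in> X) \<and>
     (\<forall>\<sigma>\<in>X. \<forall>\<tau>. \<tau> \<subseteq> \<sigma> \<longrightarrow> \<tau> \<in> X)"

text \<open>Dimensions are integers, so that the empty face has dimension -1.\<close>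

definition face_dim :: "'a set \<Rightarrow> int" where
  "face_dim \<sigma> = int (card \<sigma>) - 1"

definition faces_of_dim :: "'a set set \<Rightarrow> int \<Rightarrow> 'a set set" where
  "faces_of_dim X k = {\<sigma> \<in> X. face_dim \<sigma> = k}"

definition missing_faces :: "'a set \<Rightarrow> 'a set set \<Rightarrow> 'a set set" where
  "missing_faces V X = {\<sigma>. \<sigma> \<subseteq> V \<and> \<sigma> \<notin> X \<and> (\<forall>\<tau>. \<tau> \<subset> \<sigma> \<longrightarrow> \<tau> \<in> X)}"

text \<open>The value is only meaningful if \<open>X\<close> has a missing face.\<close>

definition max_missing_dim :: "'a set \<Rightarrow> 'a set set \<Rightarrow> int" where
  "max_missing_dim V X = Max (face_dim ` missing_faces V X)"

definition ordered_faces :: "'a set set \<Rightarrow> int \<Rightarrow> 'a list set" where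
  "ordered_faces X k = {xs. distinct xs \<and> set xs \<in> faces_of_dim X k}"

text \<open>
  Cochains are total functions on lists that vanish outside the ordered \<open>k\<close>-simplices, so that
  equality of cochains is equality of functions. For \<open>k = -1\<close> the only ordered simplex is the
  empty list, and \<open>\<phi> \<mapsto> \<phi> []\<close> identifies \<open>cochains X (-1)\<close> with the real numbers.
\<close>

definition cochains :: "'a set set \<Rightarrow> int \<Rightarrow> ('a list \<Rightarrow> real) set" where
  "cochains X k = {\<phi>.
     (\<forall>xs. xs \<notin> ordered_faces X k \<longrightarrow> \<phi> xs = 0) \<and>
     (\<forall>xs\<in>ordered_faces X k. \<forall>p. p permutes {..<length xs} \<longrightarrow>
        \<phi> (permute_list p xs) = of_int (sign p) * \<phi> xs)}"

text \<open>
  \<open>coboundary X k\<close> maps \<open>cochains X k\<close> to \<open>cochains X (k + 1)\<close>. For \<open>k = -1\<close> the formula reads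
  \<open>coboundary X (-1) \<phi> [v] = \<phi> []\<close>.
\<close>

definition coboundary :: "'a set set \<Rightarrow> int \<Rightarrow> ('a list \<Rightarrow> real) \<Rightarrow> 'a list \<Rightarrow> real" where
  "coboundary X k \<phi> = (\<lambda>xs. if xs \<in> ordered_faces X (k + 1)
     then (\<Sum>i<length xs. (-1) ^ i * \<phi> (take i xs @ drop (Suc i) xs)) else 0)"

text \<open>
  The inner product of skew-symmetric functions does not depend on the ordering chosen for each
  simplex.
\<close>

definition face_ordering :: "'a set \<Rightarrow> 'a list" where
  "face_ordering \<sigma> = (SOME xs. distinct xs \<and> set xs = \<sigma>)"

definition cochain_inner ::
  "'a set set \<Rightarrow> int \<Rightarrow> ('a list \<Rightarrow> real) \<Rightarrow> ('a list \<Rightarrow> real) \<Rightarrow> real" where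
  "cochain_inner X k \<phi> \<psi> =
     (\<Sum>\<sigma>\<in>faces_of_dim X k. \<phi> (face_ordering \<sigma>) * \<psi> (face_ordering \<sigma>))"

text \<open>
  The adjoint at \<open>\<psi> \<in> cochains X (k + 1)\<close>; it exists and is unique because the cochain spaces are
  finite-dimensional inner product spaces. The library's \<open>adjoint\<close> does not apply, as these spaces
  are subsets of a function type rather than types.
\<close>

definition coboundary_adjoint :: "'a set set \<Rightarrow> int \<Rightarrow> ('a list \<Rightarrow> real) \<Rightarrow> 'a list \<Rightarrow> real" where
  "coboundary_adjoint X k \<psi> = (THE \<phi>. \<phi> \<in> cochains X k \<and>
     (\<forall>\<theta>\<in>cochains X k.
        cochain_inner X (k + 1) (coboundary X k \<theta>) \<psi> = cochain_inner X k \<theta> \<phi>))"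

definition reduced_laplacian :: "'a set set \<Rightarrow> int \<Rightarrow> ('a list \<Rightarrow> real) \<Rightarrow> 'a list \<Rightarrow> real" where
  "reduced_laplacian X k \<phi> = (\<lambda>xs.
     coboundary X (k - 1) (coboundary_adjoint X (k - 1) \<phi>) xs +
     coboundary_adjoint X k (coboundary X k \<phi>) xs)"

definition laplacian_eigenvalue :: "'a set set \<Rightarrow> int \<Rightarrow> real \<Rightarrow> bool" where
  "laplacian_eigenvalue X k l \<longleftrightarrow>
     (\<exists>\<phi>\<in>cochains X k. \<phi> \<noteq> (\<lambda>_. 0) \<and> reduced_laplacian X k \<phi> = (\<lambda>xs. l * \<phi> xs))"

definition min_eigenvalue :: "'a set set \<Rightarrow> int \<Rightarrow> ereal" where
  "min_eigenvalue X k =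
     (if faces_of_dim X k = {} then \<infinity> else ereal (LEAST l. laplacian_eigenvalue X k l))"

end

theory Submission
  imports Defs "HOL-Analysis.Function_Topology"
begin

text \<open>
  Write \<open>\<delta>\<close> for the coboundary of the full simplex on \<open>V\<close>, and extend a \<open>k\<close>-cochain \<open>\<phi>\<close> of \<open>X\<close> by
  zero to all sets of \<open>k + 1\<close> vertices. The Laplacian of the full simplex is multiplication by \<open>n\<close>.
  Passing to \<open>X\<close> does not change the adjoint coboundary of \<open>\<phi>\<close>, while the coboundary of \<open>\<phi>\<close> loses its
  values on non-faces. Hence
  \<open>\<langle>L \<phi>, \<phi>\<rangle> = n \<parallel>\<phi>\<parallel>\<^sup>2 - (\<Sum>\<rho> \<notin> X. (\<delta> \<phi> \<rho>)\<^sup>2)\<close>,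
  which is \<open>laplacian_energy\<close>.

  Apply this formula to the slices \<open>\<phi>\<^sub>u \<tau> = \<phi> (u \<tau>)\<close>, \<open>u \<in> V\<close>, which are \<open>(k - 1)\<close>-cochains whose
  squared norms add up to \<open>(k + 1) \<parallel>\<phi>\<parallel>\<^sup>2\<close>. Since \<open>\<delta> \<phi>\<^sub>u \<rho> = \<phi> \<rho> - \<delta> \<phi> (u \<rho>)\<close> and \<open>\<phi>\<close> vanishes on
  non-faces, the non-face energies of the slices add up to the sum of \<open>(\<delta> \<phi> \<pi>)\<^sup>2\<close> over all non-faces
  \<open>\<pi>\<close> with \<open>k + 2\<close> vertices, each taken as often as \<open>\<pi>\<close> has a vertex whose deletion leaves a non-face
  (\<open>slices_energy\<close>). Deleting a vertex outside a missing face contained in \<open>\<pi>\<close> leaves a non-face, so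
  this happens at least \<open>k - d + 1\<close> times (\<open>non_face_energy_bound\<close>). Therefore
  \<open>(\<Sum>u \<in> V. \<langle>L \<phi>\<^sub>u, \<phi>\<^sub>u\<rangle>) \<le> (k + 1) n \<parallel>\<phi>\<parallel>\<^sup>2 - (k - d + 1) (n \<parallel>\<phi>\<parallel>\<^sup>2 - \<langle>L \<phi>, \<phi>\<rangle>)
     = d n \<parallel>\<phi>\<parallel>\<^sup>2 + (k - d + 1) \<langle>L \<phi>, \<phi>\<rangle>\<close>.
  For an eigenvector \<open>\<phi>\<close> of the least eigenvalue in dimension \<open>k\<close>, bounding each \<open>\<langle>L \<phi>\<^sub>u, \<phi>\<^sub>u\<rangle>\<close> from
  below by the least eigenvalue in dimension \<open>k - 1\<close> gives the theorem. The link between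
  eigenvalues and quadratic forms is \<open>min_eigenvalue_rayleigh\<close>.

  All sums run over lists of vertices instead of faces. A face with \<open>m\<close> vertices is then counted \<open>m!\<close>
  times, but no orientations have to be chosen, and splitting off the first entry of a list turns the
  sign computations into short inductions.
\<close>

section \<open>Sums over deletions of list entries\<close>

definition words :: "'a set \<Rightarrow> nat \<Rightarrow> 'a list set" where
  "words V m = {xs. set xs \<subseteq> V \<and> length xs = m}"

lemma finite_words [simp]: "finite V \<Longrightarrow> finite (words V m)"
  by (simp add: words_def finite_lists_length_eq)

lemma words_0 [simp]: "words V 0 = {[]}"
  by (auto simp: words_def)

lemma sum_words_Suc:
  "(\<Sum>xs\<in>words V (Suc m). f xs) = (\<Sum>u\<in>V. \<Sum>xs\<in>words V m. f (u # xs))"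
proof -
  have *: "words V (Suc m) = (\<lambda>(u, xs). u # xs) ` (V \<times> words V m)"
    by (auto simp: words_def length_Suc_conv image_iff)
  have "inj_on (\<lambda>(u, xs). u # xs) (V \<times> words V m)"
    by (auto simp: inj_on_def)
  then show ?thesis
    unfolding * by (simp add: sum.reindex sum.cartesian_product case_prod_unfold o_def)
qed

text \<open>
  \<open>del_sum e \<theta> xs\<close> adds up the values of \<open>\<theta>\<close> at the lists obtained from \<open>xs\<close> by deleting one entry,
  with weight \<open>e\<^sup>i\<close> for the entry at position \<open>i\<close>. For \<open>e = - 1\<close> this is the simplicial coboundary;
  for \<open>e = 1\<close> and \<open>\<theta>\<close> an indicator function it counts deletions. The recursion on the first entry is
  Cartan's formula \<open>i\<^sub>u \<delta> + \<delta> i\<^sub>u = id\<close>, where \<open>i\<^sub>u \<phi> = (\<lambda>ys. \<phi> (u # ys))\<close>; it replaces most manipulations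
  of signs.
\<close>
fun del_sum :: "real \<Rightarrow> ('a list \<Rightarrow> real) \<Rightarrow> 'a list \<Rightarrow> real" where
  "del_sum e \<theta> [] = 0"
| "del_sum e \<theta> (x # xs) = \<theta> xs + e * del_sum e (\<lambda>ys. \<theta> (x # ys)) xs"

lemma del_sum_eq:
  "del_sum e \<theta> xs = (\<Sum>i<length xs. e ^ i * \<theta> (take i xs @ drop (Suc i) xs))"
  by (induction e \<theta> xs rule: del_sum.induct)
     (simp_all add: sum.lessThan_Suc_shift sum_distrib_left mult.assoc del: sum.lessThan_Suc)

lemma del_sum_scale: "del_sum e (\<lambda>ys. c * \<theta> ys) xs = c * del_sum e \<theta> xs"
  by (simp add: del_sum_eq sum_distrib_left mult_ac)

lemma del_sum_sum: "del_sum e (\<lambda>ys. \<Sum>u\<in>A. \<theta> u ys) xs = (\<Sum>u\<in>A. del_sum e (\<theta> u) xs)"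
  unfolding del_sum_eq sum_distrib_left by (rule sum.swap)

text \<open>
  For \<open>e = - 1\<close> these are the alternating functions, for \<open>e = 1\<close> the symmetric ones. Requiring the rule
  for adjacent entries only keeps inductions on lists simple.
\<close>
definition swap_scales :: "real \<Rightarrow> ('a list \<Rightarrow> real) \<Rightarrow> bool" where
  "swap_scales e g \<longleftrightarrow> (\<forall>as x y bs. g (as @ x # y # bs) = e * g (as @ y # x # bs))"

lemma swap_scalesD: "swap_scales e g \<Longrightarrow> g (as @ x # y # bs) = e * g (as @ y # x # bs)"
  unfolding swap_scales_def by blast

lemma swap_scales_Cons: "swap_scales e g \<Longrightarrow> swap_scales e (\<lambda>ys. g (x # ys))"
  unfolding swap_scales_def by (metis append_Cons)

text \<open>
  Since \<open>g\<close> is symmetric up to the sign \<open>e\<close>, moving the deleted entry to the front gives the factor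
  \<open>e\<^sup>i\<close> once more, and it cancels the one in \<open>del_sum\<close>; so all positions contribute the same sum.
  For \<open>e = - 1\<close> this is the adjointness of coboundary and contraction, for \<open>e = 1\<close> it
  is the double counting of pairs of a list and one of its entries.
\<close>
lemma sum_mult_del_sum:
  assumes "swap_scales e g" and "e * e = 1"
  shows "(\<Sum>xs\<in>words V (Suc m). g xs * del_sum e \<theta> xs) =
         real (Suc m) * (\<Sum>xs\<in>words V (Suc m). g xs * \<theta> (tl xs))"
  using assms(1)
proof (induction m arbitrary: g \<theta>)
  case 0
  then show ?case by (simp add: sum_words_Suc)
next
  case (Suc m)
  have swap: "g (u # v # ys) = e * g (v # u # ys)" for u v ys
    using swap_scalesD[OF Suc.prems, of "[]" u v ys] by simp
  have "(\<Sum>xs\<in>words V (Suc (Suc m)). g xs * del_sum e \<theta> xs) =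
        (\<Sum>u\<in>V. \<Sum>xs\<in>words V (Suc m). g (u # xs) * \<theta> xs) +
        e * (\<Sum>u\<in>V. \<Sum>xs\<in>words V (Suc m). g (u # xs) * del_sum e (\<lambda>ys. \<theta> (u # ys)) xs)"
    unfolding sum_words_Suc[of _ _ "Suc m"]
    by (simp add: sum.distrib algebra_simps sum_distrib_left)
  also have "(\<Sum>u\<in>V. \<Sum>xs\<in>words V (Suc m). g (u # xs) * del_sum e (\<lambda>ys. \<theta> (u # ys)) xs) =
        (\<Sum>u\<in>V. real (Suc m) * (\<Sum>xs\<in>words V (Suc m). g (u # xs) * \<theta> (u # tl xs)))"
    by (intro sum.cong refl Suc.IH swap_scales_Cons Suc.prems)
  also have "\<dots> = real (Suc m) * (\<Sum>u\<in>V. \<Sum>v\<in>V. \<Sum>ys\<in>words V m. g (u # v # ys) * \<theta> (u # ys))"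
    by (simp add: sum_words_Suc sum_distrib_left)
  also have "(\<Sum>u\<in>V. \<Sum>v\<in>V. \<Sum>ys\<in>words V m. g (u # v # ys) * \<theta> (u # ys)) =
        (\<Sum>v\<in>V. \<Sum>u\<in>V. \<Sum>ys\<in>words V m. g (u # v # ys) * \<theta> (u # ys))"
    by (rule sum.swap)
  also have "\<dots> = e * (\<Sum>v\<in>V. \<Sum>xs\<in>words V (Suc m). g (v # xs) * \<theta> xs)"
    by (subst swap) (simp add: sum_words_Suc sum_distrib_left mult_ac)
  also have "e * (real (Suc m) * (e * (\<Sum>v\<in>V. \<Sum>xs\<in>words V (Suc m). g (v # xs) * \<theta> xs))) =
        (e * e) * (real (Suc m) * (\<Sum>v\<in>V. \<Sum>xs\<in>words V (Suc m). g (v # xs) * \<theta> xs))"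
    by (simp only: mult_ac)
  finally show ?case
    unfolding sum_words_Suc[of _ _ "Suc m"] by (simp add: assms(2) algebra_simps)
qed

section \<open>Alternating functions\<close>

abbreviation alternating :: "('a list \<Rightarrow> real) \<Rightarrow> bool" where
  "alternating \<equiv> swap_scales (- 1)"

abbreviation cob :: "('a list \<Rightarrow> real) \<Rightarrow> 'a list \<Rightarrow> real" where
  "cob \<equiv> del_sum (- 1)"

text \<open>
  Entries before the swapped pair are peeled off by Cartan's formula. When the pair comes first, the two
  terms that delete one of its entries trade places with opposite signs.
\<close>
lemma alternating_cob:
  assumes "alternating \<phi>"
  shows "alternating (cob \<phi>)"
proof -
  have "cob \<phi> (as @ x # y # bs) = - cob \<phi> (as @ y # x # bs)" for as x y bs
    using assms
  proof (induction as arbitrary: \<phi>)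
    case Nil
    have "(\<lambda>ys. \<phi> (x # y # ys)) = (\<lambda>ys. (- 1) * \<phi> (y # x # ys))"
      by (rule ext) (use swap_scalesD[OF Nil, of "[]" x y] in simp)
    then show ?case
      by (simp add: del_sum_scale[of _ "- 1", simplified])
  next
    case (Cons a as)
    then show ?case
      using swap_scalesD[OF Cons.prems, of as x y bs] Cons.IH[OF swap_scales_Cons[OF Cons.prems]]
      by simp
  qed
  then show ?thesis unfolding swap_scales_def mult_minus1 by blast
qed

lemma alternating_move:
  assumes "alternating \<phi>"
  shows "\<phi> (as @ x # bs @ cs) = (- 1) ^ length bs * \<phi> (as @ bs @ x # cs)"
proof (induction bs arbitrary: as)
  case (Cons b bs)
  show ?case
    using swap_scalesD[OF assms, of as x b "bs @ cs"] Cons.IH[of "as @ [b]"] by simp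
qed simp

lemma alternating_exchange:
  assumes "alternating \<phi>"
  shows "\<phi> (as @ x # bs @ y # cs) = - \<phi> (as @ y # bs @ x # cs)"
proof -
  have "\<phi> (as @ x # bs @ y # cs) = (- 1) ^ length bs * \<phi> (as @ bs @ x # y # cs)"
    by (rule alternating_move[OF assms])
  also have "\<phi> (as @ bs @ x # y # cs) = - \<phi> (as @ bs @ y # x # cs)"
    using swap_scalesD[OF assms, of "as @ bs" x y cs] by simp
  also have "(- 1) ^ length bs * (- \<phi> (as @ bs @ y # x # cs)) = - \<phi> (as @ y # bs @ x # cs)"
    using alternating_move[OF assms, of as y bs "x # cs"] by simp
  finally show ?thesis .
qed

lemma alternating_not_distinct:
  assumes "alternating \<phi>" and "\<not> distinct xs"
  shows "\<phi> xs = 0"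
proof -
  obtain as x bs cs where "xs = as @ x # bs @ x # cs"
    using not_distinct_decomp[OF assms(2)] by auto
  then have "\<phi> xs = - \<phi> xs" using alternating_exchange[OF assms(1), of as x bs x cs] by metis
  then show ?thesis by simp
qed

lemma permute_list_transpose:
  assumes "i < length xs" and "j < length xs"
  shows "permute_list (transpose i j) xs = xs[i := xs ! j, j := xs ! i]"
  using assms
  by (intro nth_equalityI) (auto simp: permute_list_def nth_list_update transpose_def)

lemma alternating_transpose:
  assumes "alternating \<phi>" and "i < j" and "j < length xs"
  shows "\<phi> (permute_list (transpose i j) xs) = - \<phi> xs"
proof -
  define as bs cs where "as = take i xs" and "bs = take (j - Suc i) (drop (Suc i) xs)"
    and "cs = drop (Suc j) xs"
  have "xs = as @ xs ! i # bs @ xs ! j # cs"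
    using assms(2,3) id_take_nth_drop[of i xs] id_take_nth_drop[of "j - Suc i" "drop (Suc i) xs"]
    by (simp add: as_def bs_def cs_def)
  moreover have "length as = i" "i + Suc (length bs) = j"
    using assms(2,3) by (simp_all add: as_def bs_def cs_def)
  ultimately obtain x y where xs: "xs = as @ x # bs @ y # cs" "i = length as" "j = length as + Suc (length bs)"
    by metis
  have "permute_list (transpose i j) xs = as @ y # bs @ x # cs"
    using assms(2,3) by (simp add: permute_list_transpose) (simp add: xs nth_append list_update_append)
  then show ?thesis using alternating_exchange[OF assms(1)] xs(1) by metis
qed

text \<open>
  Adjacent swaps determine the behaviour under all permutations, because every permutation is a product
  of transpositions and \<open>alternating_exchange\<close> reduces a transposition to adjacent swaps.
\<close>
lemma alternating_permute:
  assumes "alternating \<phi>" and "p permutes {..<length xs}"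
  shows "\<phi> (permute_list p xs) = of_int (sign p) * \<phi> xs"
proof -
  have "finite {..<length xs}" by simp
  from assms(2) this
  have "\<forall>ys. length ys = length xs \<longrightarrow> \<phi> (permute_list p ys) = of_int (sign p) * \<phi> ys"
  proof (induction rule: permutes_induct)
    case id
    then show ?case by simp
  next
    case (swap a b p)
    show ?case
    proof (intro allI impI)
      fix ys :: "'a list" assume len: "length ys = length xs"
      have "\<phi> (permute_list (transpose a b) ys) = - \<phi> ys"
        using swap.hyps len alternating_transpose[OF assms(1), of a b ys]
          alternating_transpose[OF assms(1), of b a ys]
        by (cases a b rule: linorder_cases) (auto simp: transpose_commute)
      moreover have "permute_list (transpose a b \<circ> p) ys = permute_list p (permute_list (transpose a b) ys)"
        using swap.hyps len by (intro permute_list_compose) simp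
      moreover have "sign (transpose a b \<circ> p) = - sign p"
        using swap.hyps by (subst sign_compose) 
          (auto simp: sign_swap_id permutation_swap_id intro: permutation_permutes[THEN iffD2])
      ultimately show "\<phi> (permute_list (transpose a b \<circ> p) ys) = of_int (sign (transpose a b \<circ> p)) * \<phi> ys"
        using swap.IH len by simp
    qed
  qed
  then show ?thesis by simp
qed

section \<open>The full simplex\<close>

text \<open>
  On alternating functions this is the adjoint of the coboundary of the full simplex on \<open>V\<close>. The factor
  in \<open>sum_mult_cob\<close> arises because sums over lists count every face once for each of its orderings.
\<close>
definition contr :: "'a set \<Rightarrow> ('a list \<Rightarrow> real) \<Rightarrow> 'a list \<Rightarrow> real" where
  "contr V \<phi> ys = (\<Sum>u\<in>V. \<phi> (u # ys))"

lemma alternating_contr: "alternating \<phi> \<Longrightarrow> alternating (contr V \<phi>)"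
  unfolding swap_scales_def contr_def sum_distrib_left
  by (intro allI sum.cong refl) (metis append_Cons)

lemma sum_mult_cob:
  assumes "alternating \<psi>"
  shows "(\<Sum>xs\<in>words V (Suc m). \<psi> xs * cob \<theta> xs) =
         real (Suc m) * (\<Sum>ys\<in>words V m. contr V \<psi> ys * \<theta> ys)"
proof -
  have "(\<Sum>xs\<in>words V (Suc m). \<psi> xs * \<theta> (tl xs)) = (\<Sum>ys\<in>words V m. contr V \<psi> ys * \<theta> ys)"
    unfolding sum_words_Suc contr_def sum_distrib_right list.sel by (rule sum.swap)
  then show ?thesis using sum_mult_del_sum[OF assms, where V = V and m = m and \<theta> = \<theta>] by simp
qed

text \<open>
  The Laplacian of the full simplex on \<open>V\<close> is the scalar \<open>card V\<close>; this is the corresponding identity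
  of quadratic forms. Summing Cartan's formula over \<open>u \<in> V\<close> gives \<open>contr_cob\<close>, and adjointness
  does the rest.
\<close>
lemma sum_cob_squared:
  assumes "alternating \<phi>"
  shows "(\<Sum>xs\<in>words V (Suc (Suc m)). (cob \<phi> xs)\<^sup>2) =
         real (m + 2) * (real (card V) * (\<Sum>xs\<in>words V (Suc m). (\<phi> xs)\<^sup>2)
           - real (Suc m) * (\<Sum>ys\<in>words V m. (contr V \<phi> ys)\<^sup>2))"
proof -
  have contr_cob: "contr V (cob \<phi>) ys = real (card V) * \<phi> ys - cob (contr V \<phi>) ys" for ys
  proof -
    have "cob (contr V \<phi>) ys = (\<Sum>u\<in>V. cob (\<lambda>zs. \<phi> (u # zs)) ys)"
      unfolding contr_def by (rule del_sum_sum)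
    then show ?thesis by (simp add: contr_def sum_subtractf)
  qed
  have "(\<Sum>xs\<in>words V (Suc (Suc m)). (cob \<phi> xs)\<^sup>2) =
      real (Suc (Suc m)) * (\<Sum>ys\<in>words V (Suc m). contr V (cob \<phi>) ys * \<phi> ys)"
    unfolding power2_eq_square by (rule sum_mult_cob[OF alternating_cob[OF assms]])
  also have "(\<Sum>ys\<in>words V (Suc m). contr V (cob \<phi>) ys * \<phi> ys) =
      real (card V) * (\<Sum>ys\<in>words V (Suc m). (\<phi> ys)\<^sup>2)
        - (\<Sum>ys\<in>words V (Suc m). \<phi> ys * cob (contr V \<phi>) ys)"
    unfolding contr_cob by (simp add: algebra_simps power2_eq_square sum_subtractf sum_distrib_left)
  also have "(\<Sum>ys\<in>words V (Suc m). \<phi> ys * cob (contr V \<phi>) ys) =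
      real (Suc m) * (\<Sum>ys\<in>words V m. (contr V \<phi> ys)\<^sup>2)"
    unfolding power2_eq_square by (rule sum_mult_cob[OF assms])
  finally show ?thesis by simp
qed

section \<open>The Laplacian of a simplicial complex as a quadratic form\<close>

locale finite_complex =
  fixes V :: "'a set" and X :: "'a set set"
  assumes complex: "abstract_simplicial_complex V X"
begin

lemma finite_V [simp]: "finite V"
  using complex by (simp add: abstract_simplicial_complex_def)

lemma face_subset: "\<sigma> \<in> X \<Longrightarrow> \<sigma> \<subseteq> V"
  using complex by (auto simp: abstract_simplicial_complex_def)

lemma face_mono: "\<sigma> \<in> X \<Longrightarrow> \<tau> \<subseteq> \<sigma> \<Longrightarrow> \<tau> \<in> X"
  using complex by (auto simp: abstract_simplicial_complex_def)

definition face_words :: "nat \<Rightarrow> 'a list set" where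
  "face_words m = {xs. distinct xs \<and> set xs \<in> X \<and> length xs = m}"

lemma face_words_subset: "face_words m \<subseteq> words V m"
  using face_subset by (auto simp: face_words_def words_def)

lemma ordered_faces_eq: "ordered_faces X (int m - 1) = face_words m"
  by (auto simp: ordered_faces_def face_words_def faces_of_dim_def face_dim_def distinct_card)

abbreviation cochains_on :: "nat \<Rightarrow> ('a list \<Rightarrow> real) set" where
  "cochains_on m \<equiv> cochains X (int m - 1)"

abbreviation inner_on :: "nat \<Rightarrow> ('a list \<Rightarrow> real) \<Rightarrow> ('a list \<Rightarrow> real) \<Rightarrow> real" where
  "inner_on m \<equiv> cochain_inner X (int m - 1)"

text \<open>
  An adjacent swap is a transposition, hence odd, and reordering a list does not change whether it
  spans a face; the converse direction is \<open>alternating_permute\<close>.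
\<close>
lemma cochains_on_iff:
  "\<phi> \<in> cochains_on m \<longleftrightarrow> alternating \<phi> \<and> (\<forall>xs. xs \<notin> face_words m \<longrightarrow> \<phi> xs = 0)"
proof (intro iffI conjI)
  assume \<phi>: "\<phi> \<in> cochains_on m"
  then show zero: "\<forall>xs. xs \<notin> face_words m \<longrightarrow> \<phi> xs = 0"
    by (simp add: cochains_def ordered_faces_eq)
  have "\<phi> (as @ x # y # bs) = - \<phi> (as @ y # x # bs)" for as x y bs
  proof (cases "as @ y # x # bs \<in> face_words m")
    case True
    let ?xs = "as @ y # x # bs" and ?t = "transpose (length as) (Suc (length as))"
    have "?t permutes {..<length ?xs}"
      by (rule permutes_swap_id) simp_all
    then have "\<phi> (permute_list ?t ?xs) = of_int (sign ?t) * \<phi> ?xs"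
      using \<phi> True unfolding cochains_def ordered_faces_eq by blast
    moreover have "permute_list ?t ?xs = as @ x # y # bs"
      by (subst permute_list_transpose) (simp_all add: nth_append list_update_append)
    ultimately show ?thesis by (simp add: sign_swap_id)
  next
    case False
    then have "as @ x # y # bs \<notin> face_words m"
      by (auto simp: face_words_def insert_commute)
    with False zero show ?thesis by simp
  qed
  then show "alternating \<phi>" unfolding swap_scales_def mult_minus1 by blast
next
  assume "alternating \<phi> \<and> (\<forall>xs. xs \<notin> face_words m \<longrightarrow> \<phi> xs = 0)"
  then show "\<phi> \<in> cochains_on m"
    using alternating_permute[of \<phi>] unfolding cochains_def ordered_faces_eq by blast
qed

lemma cochains_on_alternating: "\<phi> \<in> cochains_on m \<Longrightarrow> alternating \<phi>"
  by (rule cochains_on_iff[THEN iffD1, THEN conjunct1])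

lemma cochains_on_zero: "\<phi> \<in> cochains_on m \<Longrightarrow> xs \<notin> face_words m \<Longrightarrow> \<phi> xs = 0"
  by (rule cochains_on_iff[THEN iffD1, THEN conjunct2, rule_format])

lemma restrict_alternating:
  assumes "alternating \<phi>"
  shows "(\<lambda>xs. if xs \<in> face_words m then \<phi> xs else 0) \<in> cochains_on m"
proof -
  have "alternating (\<lambda>xs. if xs \<in> face_words m then \<phi> xs else 0)"
    unfolding swap_scales_def
  proof (intro allI)
    fix as bs :: "'a list" and x y
    have "as @ x # y # bs \<in> face_words m \<longleftrightarrow> as @ y # x # bs \<in> face_words m"
      by (auto simp: face_words_def insert_commute)
    then show "(if as @ x # y # bs \<in> face_words m then \<phi> (as @ x # y # bs) else 0) =
        - 1 * (if as @ y # x # bs \<in> face_words m then \<phi> (as @ y # x # bs) else 0)"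
      using swap_scalesD[OF assms, of as x y bs] by simp
  qed
  then show ?thesis by (simp add: cochains_on_iff)
qed

lemma cochains_on_slice:
  assumes "\<phi> \<in> cochains_on (Suc m)"
  shows "(\<lambda>ys. \<phi> (u # ys)) \<in> cochains_on m"
proof -
  have "\<phi> (u # ys) = 0" if "ys \<notin> face_words m" for ys
    using that by (intro cochains_on_zero[OF assms]) (auto simp: face_words_def intro: face_mono)
  then show ?thesis
    using swap_scales_Cons[OF cochains_on_alternating[OF assms]] by (simp add: cochains_on_iff)
qed

lemma cochains_on_contr:
  assumes "\<phi> \<in> cochains_on (Suc m)"
  shows "contr V \<phi> \<in> cochains_on m"
  using alternating_contr[OF cochains_on_alternating[OF assms]]
    cochains_on_zero[OF cochains_on_slice[OF assms]]
  by (simp add: cochains_on_iff contr_def)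

lemma cochains_on_lincomb:
  assumes "\<phi> \<in> cochains_on m" and "\<psi> \<in> cochains_on m"
  shows "(\<lambda>xs. a * \<phi> xs + b * \<psi> xs) \<in> cochains_on m"
proof -
  have "alternating (\<lambda>xs. a * \<phi> xs + b * \<psi> xs)"
    unfolding swap_scales_def
  proof (intro allI)
    fix as bs :: "'a list" and x y
    show "a * \<phi> (as @ x # y # bs) + b * \<psi> (as @ x # y # bs) =
        - 1 * (a * \<phi> (as @ y # x # bs) + b * \<psi> (as @ y # x # bs))"
      using swap_scalesD[OF cochains_on_alternating[OF assms(1)], of as x y bs]
        swap_scalesD[OF cochains_on_alternating[OF assms(2)], of as x y bs]
      by simp
  qed
  then show ?thesis
    using cochains_on_zero[OF assms(1)] cochains_on_zero[OF assms(2)] by (simp add: cochains_on_iff)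
qed

text \<open>
  A product of two cochains takes the same value on all \<open>m!\<close> orderings of a face, so the arbitrary
  choice of an ordering can be traded for a sum over all lists.
\<close>
lemma inner_on_words:
  assumes "\<phi> \<in> cochains_on m" and "\<psi> \<in> cochains_on m"
  shows "fact m * inner_on m \<phi> \<psi> = (\<Sum>xs\<in>words V m. \<phi> xs * \<psi> xs)"
proof -
  let ?F = "faces_of_dim X (int m - 1)"
  have F: "\<sigma> \<in> ?F \<longleftrightarrow> \<sigma> \<in> X \<and> card \<sigma> = m" for \<sigma>
    by (auto simp: faces_of_dim_def face_dim_def)
  have finF: "finite ?F"
    by (rule finite_subset[of _ "Pow V"]) (use F face_subset in auto)
  have finW: "finite (face_words m)"
    using face_words_subset finite_words[OF finite_V] by (rule finite_subset)
  have "(\<Sum>xs\<in>words V m. \<phi> xs * \<psi> xs) = (\<Sum>xs\<in>face_words m. \<phi> xs * \<psi> xs)"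
    by (rule sum.mono_neutral_right)
      (use face_words_subset cochains_on_zero[OF assms(1)] in auto)
  also have "\<dots> = (\<Sum>\<sigma>\<in>?F. \<Sum>xs\<in>{xs \<in> face_words m. set xs = \<sigma>}. \<phi> xs * \<psi> xs)"
  proof (rule sum.group[symmetric, OF finW finF], rule image_subsetI)
    show "set xs \<in> ?F" if "xs \<in> face_words m" for xs
      using that unfolding F by (auto simp: face_words_def distinct_card)
  qed
  also have "\<dots> = (\<Sum>\<sigma>\<in>?F. fact m * (\<phi> (face_ordering \<sigma>) * \<psi> (face_ordering \<sigma>)))"
  proof (rule sum.cong[OF refl])
    fix \<sigma> assume \<sigma>: "\<sigma> \<in> ?F"
    then have fin: "finite \<sigma>"
      using finite_subset[OF face_subset finite_V] by (simp add: F)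
    have eq: "{xs \<in> face_words m. set xs = \<sigma>} = permutations_of_set \<sigma>"
      using \<sigma> by (auto simp: face_words_def F permutations_of_set_def distinct_card)
    have ord: "distinct (face_ordering \<sigma>)" "set (face_ordering \<sigma>) = \<sigma>"
      using someI_ex[of "\<lambda>xs. distinct xs \<and> set xs = \<sigma>"] finite_distinct_list[OF fin]
      unfolding face_ordering_def by blast+
    have const: "\<phi> xs * \<psi> xs = \<phi> (face_ordering \<sigma>) * \<psi> (face_ordering \<sigma>)"
      if "xs \<in> permutations_of_set \<sigma>" for xs
    proof -
      have "mset xs = mset (face_ordering \<sigma>)"
        using that ord by (auto simp: permutations_of_set_def set_eq_iff_mset_eq_distinct)
      then obtain p where p: "p permutes {..<length (face_ordering \<sigma>)}"
        "permute_list p (face_ordering \<sigma>) = xs"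
        by (rule mset_eq_permutation)
      show ?thesis
        using alternating_permute[OF cochains_on_alternating[OF assms(1)] p(1)]
          alternating_permute[OF cochains_on_alternating[OF assms(2)] p(1)] p(2)
        by (cases p rule: sign_cases) auto
    qed
    have "(\<Sum>xs\<in>permutations_of_set \<sigma>. \<phi> xs * \<psi> xs) =
        (\<Sum>xs\<in>permutations_of_set \<sigma>. \<phi> (face_ordering \<sigma>) * \<psi> (face_ordering \<sigma>))"
      by (intro sum.cong refl const)
    then show "(\<Sum>xs\<in>{xs \<in> face_words m. set xs = \<sigma>}. \<phi> xs * \<psi> xs) =
        fact m * (\<phi> (face_ordering \<sigma>) * \<psi> (face_ordering \<sigma>))"
      unfolding eq using \<sigma> fin by (simp add: F)
  qed
  finally show ?thesis by (simp add: cochain_inner_def sum_distrib_left)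
qed

lemma inner_on_commute: "inner_on m \<phi> \<psi> = inner_on m \<psi> \<phi>"
  by (simp add: cochain_inner_def mult.commute)

lemma inner_on_lincomb:
  "inner_on m \<theta> (\<lambda>xs. a * \<phi> xs + b * \<psi> xs) = a * inner_on m \<theta> \<phi> + b * inner_on m \<theta> \<psi>"
  by (simp add: cochain_inner_def algebra_simps sum.distrib sum_distrib_left)

lemma inner_on_lincomb_left:
  "inner_on m (\<lambda>xs. a * \<phi> xs + b * \<psi> xs) \<theta> = a * inner_on m \<phi> \<theta> + b * inner_on m \<psi> \<theta>"
  by (simp add: cochain_inner_def algebra_simps sum.distrib sum_distrib_left)

lemma inner_on_definite:
  assumes "\<phi> \<in> cochains_on m" and "inner_on m \<phi> \<phi> = 0"
  shows "\<phi> = (\<lambda>_. 0)"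
proof
  fix xs
  have "(\<Sum>xs\<in>words V m. \<phi> xs * \<phi> xs) = 0"
    using inner_on_words[OF assms(1,1)] assms(2) by simp
  then have "\<forall>xs\<in>words V m. \<phi> xs = 0"
    by (subst (asm) sum_nonneg_eq_0_iff) auto
  then show "\<phi> xs = 0"
    using face_words_subset cochains_on_zero[OF assms(1)] by blast
qed

lemma inner_on_nonneg: "0 \<le> inner_on m \<phi> \<phi>"
  by (simp add: cochain_inner_def sum_nonneg)

lemma coboundary_on_eq:
  "coboundary X (int m - 1) \<phi> = (\<lambda>xs. if xs \<in> face_words (Suc m) then cob \<phi> xs else 0)"
  using ordered_faces_eq[of "Suc m"] by (simp add: coboundary_def del_sum_eq fun_eq_iff)

lemma cochains_on_coboundary:
  "\<phi> \<in> cochains_on m \<Longrightarrow> coboundary X (int m - 1) \<phi> \<in> cochains_on (Suc m)"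
  unfolding coboundary_on_eq
  by (intro restrict_alternating alternating_cob cochains_on_alternating)

lemma inner_coboundary:
  assumes "\<theta> \<in> cochains_on m" and "\<psi> \<in> cochains_on (Suc m)"
  shows "inner_on (Suc m) (coboundary X (int m - 1) \<theta>) \<psi> = inner_on m \<theta> (contr V \<psi>)"
proof -
  have "fact (Suc m) * inner_on (Suc m) (coboundary X (int m - 1) \<theta>) \<psi> =
      (\<Sum>xs\<in>words V (Suc m). \<psi> xs * cob \<theta> xs)"
    unfolding inner_on_words[OF cochains_on_coboundary[OF assms(1)] assms(2)]
    by (intro sum.cong refl) (simp add: coboundary_on_eq cochains_on_zero[OF assms(2)])
  also have "\<dots> = real (Suc m) * (\<Sum>ys\<in>words V m. \<theta> ys * contr V \<psi> ys)"
    by (simp add: sum_mult_cob[OF cochains_on_alternating[OF assms(2)]] mult.commute)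
  also have "\<dots> = fact (Suc m) * inner_on m \<theta> (contr V \<psi>)"
    using inner_on_words[OF assms(1) cochains_on_contr[OF assms(2)]] by (simp add: algebra_simps)
  finally show ?thesis by (simp del: fact_Suc)
qed

text \<open>
  Contraction is an adjoint, and definiteness of the inner product leaves room for no other, so the
  definite description in the definition of the adjoint denotes it.
\<close>
lemma coboundary_adjoint_eq:
  assumes "\<psi> \<in> cochains_on (Suc m)"
  shows "coboundary_adjoint X (int m - 1) \<psi> = contr V \<psi>"
  unfolding coboundary_adjoint_def
proof (rule the_equality)
  show "contr V \<psi> \<in> cochains_on m \<and> (\<forall>\<theta>\<in>cochains_on m.
      cochain_inner X (int m - 1 + 1) (coboundary X (int m - 1) \<theta>) \<psi> = inner_on m \<theta> (contr V \<psi>))"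
    using inner_coboundary[OF _ assms] cochains_on_contr[OF assms] by simp
next
  fix \<phi>
  assume "\<phi> \<in> cochains_on m \<and> (\<forall>\<theta>\<in>cochains_on m.
      cochain_inner X (int m - 1 + 1) (coboundary X (int m - 1) \<theta>) \<psi> = inner_on m \<theta> \<phi>)"
  then have \<phi>: "\<phi> \<in> cochains_on m"
    and eq: "\<And>\<theta>. \<theta> \<in> cochains_on m \<Longrightarrow> inner_on m \<theta> (contr V \<psi>) = inner_on m \<theta> \<phi>"
    using inner_coboundary[OF _ assms] by auto
  \<comment> \<open>The factors \<open>1\<close> here and below give the difference the shape of \<open>inner_on_lincomb\<close>.\<close>
  let ?\<delta> = "\<lambda>xs. 1 * contr V \<psi> xs + (- 1) * \<phi> xs"
  have \<delta>: "?\<delta> \<in> cochains_on m"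
    by (rule cochains_on_lincomb[OF cochains_on_contr[OF assms] \<phi>])
  then have "inner_on m ?\<delta> ?\<delta> = 0"
    unfolding inner_on_lincomb using eq[OF \<delta>] by simp
  from inner_on_definite[OF \<delta> this] show "\<phi> = contr V \<psi>"
    by (simp add: fun_eq_iff)
qed

abbreviation laplacian :: "nat \<Rightarrow> ('a list \<Rightarrow> real) \<Rightarrow> 'a list \<Rightarrow> real" where
  "laplacian m \<equiv> reduced_laplacian X (int m)"

lemma laplacian_eq:
  assumes "\<phi> \<in> cochains_on (Suc m)"
  shows "laplacian m \<phi> = (\<lambda>xs. 1 * coboundary X (int m - 1) (contr V \<phi>) xs +
           1 * contr V (coboundary X (int m) \<phi>) xs)"
proof -
  have "coboundary X (int m) \<phi> \<in> cochains_on (Suc (Suc m))"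
    using cochains_on_coboundary[OF assms] by simp
  from coboundary_adjoint_eq[OF this]
  have "coboundary_adjoint X (int m) (coboundary X (int m) \<phi>) = contr V (coboundary X (int m) \<phi>)"
    by simp
  then show ?thesis
    unfolding reduced_laplacian_def coboundary_adjoint_eq[OF assms] by simp
qed

lemma cochains_on_laplacian:
  assumes "\<phi> \<in> cochains_on (Suc m)"
  shows "laplacian m \<phi> \<in> cochains_on (Suc m)"
  unfolding laplacian_eq[OF assms]
  using cochains_on_coboundary[OF assms] cochains_on_contr[of _ "Suc m"]
  by (intro cochains_on_lincomb cochains_on_coboundary[OF cochains_on_contr[OF assms]]) simp

lemma inner_laplacian:
  assumes "\<phi> \<in> cochains_on (Suc m)" and "\<psi> \<in> cochains_on (Suc m)"
  shows "inner_on (Suc m) \<psi> (laplacian m \<phi>) = inner_on m (contr V \<psi>) (contr V \<phi>) +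
           inner_on (Suc (Suc m)) (coboundary X (int m) \<psi>) (coboundary X (int m) \<phi>)"
proof -
  have "inner_on (Suc m) \<psi> (coboundary X (int m - 1) (contr V \<phi>)) = inner_on m (contr V \<psi>) (contr V \<phi>)"
    using inner_coboundary[OF cochains_on_contr[OF assms(1)] assms(2)]
    by (simp only: inner_on_commute)
  moreover have "inner_on (Suc (Suc m)) (coboundary X (int m) \<psi>) (coboundary X (int m) \<phi>) =
      inner_on (Suc m) \<psi> (contr V (coboundary X (int m) \<phi>))"
    using inner_coboundary[OF assms(2), of "coboundary X (int m) \<phi>"] cochains_on_coboundary[OF assms(1)]
    by simp
  ultimately show ?thesis unfolding laplacian_eq[OF assms(1)] inner_on_lincomb by simp
qed

text \<open>
  A real-valued indicator, so that it can be a weight in sums and an argument of \<open>del_sum\<close>. Lists with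
  a repeated entry count as non-faces.
\<close>
definition non_face :: "'a list \<Rightarrow> real" where
  "non_face xs = of_bool (\<not> (distinct xs \<and> set xs \<in> X))"

text \<open>
  Extended by zero, a cochain of \<open>X\<close> becomes a cochain of the full simplex. Its contraction is the same
  in both complexes, and its two coboundaries differ exactly on the non-faces. Hence the energy in \<open>X\<close>
  is the energy in the full simplex, which \<open>sum_cob_squared\<close> gives, minus the part carried by non-faces.
\<close>
lemma laplacian_energy:
  assumes "\<phi> \<in> cochains_on (Suc m)"
  shows "fact (Suc m) * inner_on (Suc m) \<phi> (laplacian m \<phi>) =
    real (card V) * (\<Sum>xs\<in>words V (Suc m). (\<phi> xs)\<^sup>2)
      - (\<Sum>xs\<in>words V (m + 2). non_face xs * (cob \<phi> xs)\<^sup>2) / real (m + 2)"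
proof -
  let ?d = "coboundary X (int m) \<phi>"
  let ?D = "\<Sum>xs\<in>words V (Suc (Suc m)). (?d xs)\<^sup>2"
  let ?B = "\<Sum>xs\<in>words V (Suc (Suc m)). non_face xs * (cob \<phi> xs)\<^sup>2"
  let ?C = "\<Sum>ys\<in>words V m. (contr V \<phi> ys)\<^sup>2"
  let ?N = "\<Sum>xs\<in>words V (Suc m). (\<phi> xs)\<^sup>2"
  have c: "contr V \<phi> \<in> cochains_on m" and d: "?d \<in> cochains_on (Suc (Suc m))"
    using cochains_on_contr[OF assms] cochains_on_coboundary[OF assms] by simp_all
  have "fact m * inner_on m (contr V \<phi>) (contr V \<phi>) = ?C"
    using inner_on_words[OF c c] by (simp add: power2_eq_square)
  moreover have "fact (Suc (Suc m)) * inner_on (Suc (Suc m)) ?d ?d = ?D"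
    using inner_on_words[OF d d] by (simp add: power2_eq_square)
  moreover have "fact (Suc m) * (a + b) =
      real (Suc m) * (fact m * a) + fact (Suc (Suc m)) * b / real (m + 2)" for a b :: real
    by (simp add: field_simps)
  ultimately have E: "fact (Suc m) * inner_on (Suc m) \<phi> (laplacian m \<phi>) =
      real (Suc m) * ?C + ?D / real (m + 2)"
    unfolding inner_laplacian[OF assms assms] by metis
  have "(cob \<phi> xs)\<^sup>2 = (?d xs)\<^sup>2 + non_face xs * (cob \<phi> xs)\<^sup>2" if "xs \<in> words V (Suc (Suc m))" for xs
    using that coboundary_on_eq[of "Suc m" \<phi>]
    by (auto simp: non_face_def words_def face_words_def)
  then have "(\<Sum>xs\<in>words V (Suc (Suc m)). (cob \<phi> xs)\<^sup>2) = ?D + ?B"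
    by (simp add: sum.distrib[symmetric])
  then have "?D = real (m + 2) * (real (card V) * ?N - real (Suc m) * ?C) - ?B"
    using sum_cob_squared[OF cochains_on_alternating[OF assms], where V = V and m = m] by simp
  then have "?D / real (m + 2) = real (card V) * ?N - real (Suc m) * ?C - ?B / real (m + 2)"
    by (simp add: diff_divide_distrib)
  then show ?thesis unfolding E by simp
qed

end

section \<open>The least eigenvalue as minimum of the Rayleigh quotient\<close>

text \<open>
  Used to exhibit a nonzero alternating function: the Vandermonde product changes sign under swaps for
  an arbitrary labelling \<open>r\<close> of the vertices, and no explicit sign of an ordering is needed.
\<close>
fun vandermonde :: "('a \<Rightarrow> real) \<Rightarrow> 'a list \<Rightarrow> real" where
  "vandermonde r [] = 1"
| "vandermonde r (x # xs) = (\<Prod>y\<leftarrow>xs. r y - r x) * vandermonde r xs"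

lemma alternating_vandermonde: "alternating (vandermonde r)"
  unfolding swap_scales_def
proof (intro allI)
  fix as bs :: "'a list" and x y
  show "vandermonde r (as @ x # y # bs) = - 1 * vandermonde r (as @ y # x # bs)"
    by (induction as) (simp_all add: algebra_simps)
qed

lemma vandermonde_nonzero:
  "distinct xs \<Longrightarrow> inj_on r (set xs) \<Longrightarrow> vandermonde r xs \<noteq> 0"
  by (induction xs) (auto simp: prod_list_zero_iff inj_on_def)

lemma nonneg_quadratic_imp_linear_coeff_zero:
  fixes c d :: real
  assumes "\<And>t. 0 \<le> 2 * t * c + t\<^sup>2 * d"
  shows "c = 0"
proof (rule ccontr)
  assume "c \<noteq> 0"
  \<comment> \<open>At \<open>t = - c / D\<close> the linear term dominates, because \<open>d < D\<close>.\<close>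
  define D where "D = \<bar>d\<bar> + 1"
  have D: "D > 0" "d < D" by (simp_all add: D_def)
  have "0 \<le> (2 * (- c / D) * c + (- c / D)\<^sup>2 * d) * D\<^sup>2"
    using assms[of "- c / D"] by simp
  also have "\<dots> = c\<^sup>2 * (d - 2 * D)"
    using D by (simp add: field_simps power2_eq_square)
  finally have "0 \<le> d - 2 * D"
    using \<open>c \<noteq> 0\<close> by (simp add: zero_le_mult_iff)
  then show False using D by simp
qed

lemma continuous_on_coordinate [continuous_intros]:
  "continuous_on A (\<lambda>\<phi> :: 'i \<Rightarrow> real. \<phi> i)"
  by (rule continuous_on_subset[OF continuous_on_product_coordinates]) simp

context finite_complex
begin

lemma ex_nonzero_cochain:
  assumes "faces_of_dim X (int m - 1) \<noteq> {}"
  obtains \<phi> where "\<phi> \<in> cochains_on m" and "\<phi> \<noteq> (\<lambda>_. 0)"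
proof -
  obtain \<sigma> where \<sigma>: "\<sigma> \<in> X" "card \<sigma> = m"
    using assms by (auto simp: faces_of_dim_def face_dim_def)
  obtain xs where xs: "set xs = \<sigma>" "distinct xs"
    using finite_distinct_list[OF finite_subset[OF face_subset[OF \<sigma>(1)] finite_V]] by blast
  then have "xs \<in> face_words m"
    using \<sigma> distinct_card[OF xs(2)] by (simp add: face_words_def)
  obtain f :: "'a \<Rightarrow> nat" where "inj_on f V"
    using finite_imp_inj_to_nat_seg[OF finite_V] by blast
  then have "inj_on f (set xs)"
    using inj_on_subset face_subset[OF \<sigma>(1)] xs(1) by blast
  then have "inj_on (\<lambda>v. real (f v)) (set xs)"
    by (simp add: inj_on_def)
  then have "vandermonde (\<lambda>v. real (f v)) xs \<noteq> 0"
    by (rule vandermonde_nonzero[OF xs(2)])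
  with \<open>xs \<in> face_words m\<close>
  have "(\<lambda>ys. if ys \<in> face_words m then vandermonde (\<lambda>v. real (f v)) ys else 0) \<noteq> (\<lambda>_. 0)"
    by (auto simp: fun_eq_iff)
  with restrict_alternating[OF alternating_vandermonde] show ?thesis by (rule that)
qed

text \<open>
  In the product topology on real functions on lists the unit sphere is a closed subset of a cube, and
  the cube is compact by Tychonoff's theorem.
\<close>
lemma compact_unit_cochains:
  "compact {\<phi> \<in> cochains_on m. (\<Sum>xs\<in>words V m. (\<phi> xs)\<^sup>2) = 1}"
proof -
  let ?K = "{\<phi> \<in> cochains_on m. (\<Sum>xs\<in>words V m. (\<phi> xs)\<^sup>2) = 1}"
  let ?P = "Pi\<^sub>E UNIV (\<lambda>_ :: 'a list. {-1..1 :: real})"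
  have "compactin (product_topology (\<lambda>_. euclidean) UNIV) ?P"
    by (subst compactin_PiE) simp
  then have "compact ?P"
    by (simp add: euclidean_product_topology)
  moreover have "closed ?K"
  proof -
    have "?K = {\<phi>. (\<forall>as x y bs. \<phi> (as @ x # y # bs) = - 1 * \<phi> (as @ y # x # bs)) \<and>
        (\<forall>xs. xs \<in> face_words m \<or> \<phi> xs = 0) \<and> (\<Sum>xs\<in>words V m. (\<phi> xs)\<^sup>2) = 1}"
      unfolding cochains_on_iff swap_scales_def by blast
    also have "closed \<dots>"
      by (intro closed_Collect_conj closed_Collect_all closed_Collect_disj closed_Collect_const
          closed_Collect_eq continuous_intros)
    finally show ?thesis .
  qed
  moreover have "?K \<subseteq> ?P"
  proof
    fix \<phi> assume \<phi>: "\<phi> \<in> ?K"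
    have "\<phi> xs \<in> {-1..1}" for xs
    proof (cases "xs \<in> words V m")
      case True
      then have "(\<phi> xs)\<^sup>2 \<le> (\<Sum>xs\<in>words V m. (\<phi> xs)\<^sup>2)"
        by (intro member_le_sum) simp_all
      then have "\<bar>\<phi> xs\<bar> \<le> 1" using \<phi> by (simp add: abs_square_le_1)
      then show ?thesis by (simp add: abs_le_iff)
    next
      case False
      then have "xs \<notin> face_words m" using face_words_subset by blast
      then show ?thesis using cochains_on_zero[of \<phi> m xs] \<phi> by simp
    qed
    then show "\<phi> \<in> ?P" by (auto simp: PiE_iff)
  qed
  ultimately show ?thesis
    using compact_Int_closed[of ?P ?K] by (simp add: Int_absorb1)
qed

text \<open>
  The energy formula expresses the quadratic form of the Laplacian by finitely many values of the
  cochain, hence it is continuous and attains its minimum on the compact unit sphere; homogeneity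
  extends the bound to all cochains.
\<close>
lemma rayleigh_quotient_attains_min:
  assumes "faces_of_dim X (int m) \<noteq> {}"
  obtains l \<phi> where "\<phi> \<in> cochains_on (Suc m)" and "\<phi> \<noteq> (\<lambda>_. 0)"
    and "inner_on (Suc m) \<phi> (laplacian m \<phi>) = l * inner_on (Suc m) \<phi> \<phi>"
    and "\<And>\<psi>. \<psi> \<in> cochains_on (Suc m) \<Longrightarrow>
           l * inner_on (Suc m) \<psi> \<psi> \<le> inner_on (Suc m) \<psi> (laplacian m \<psi>)"
proof -
  define N where "N \<phi> = (\<Sum>xs\<in>words V (Suc m). (\<phi> xs)\<^sup>2)" for \<phi> :: "'a list \<Rightarrow> real"
  define E where "E \<phi> = real (card V) * N \<phi>
      - (\<Sum>xs\<in>words V (m + 2). non_face xs * (cob \<phi> xs)\<^sup>2) / real (m + 2)"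
    for \<phi> :: "'a list \<Rightarrow> real"
  let ?K = "{\<phi> \<in> cochains_on (Suc m). N \<phi> = 1}"
  have N_inner: "fact (Suc m) * inner_on (Suc m) \<phi> \<phi> = N \<phi>" if "\<phi> \<in> cochains_on (Suc m)" for \<phi>
    using inner_on_words[OF that that] unfolding N_def power2_eq_square .
  have E_inner: "fact (Suc m) * inner_on (Suc m) \<phi> (laplacian m \<phi>) = E \<phi>"
    if "\<phi> \<in> cochains_on (Suc m)" for \<phi>
    using laplacian_energy[OF that] unfolding E_def N_def .
  have N_scale: "N (\<lambda>xs. c * \<phi> xs) = c\<^sup>2 * N \<phi>" for c \<phi>
    by (simp add: N_def power_mult_distrib sum_distrib_left)
  have E_scale: "E (\<lambda>xs. c * \<phi> xs) = c\<^sup>2 * E \<phi>" for c \<phi>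
    unfolding E_def N_scale del_sum_scale
    by (simp add: power_mult_distrib sum_distrib_left algebra_simps)
  have N_pos: "N \<phi> > 0" if "\<phi> \<in> cochains_on (Suc m)" "\<phi> \<noteq> (\<lambda>_. 0)" for \<phi>
  proof -
    have "inner_on (Suc m) \<phi> \<phi> > 0"
      using inner_on_definite[OF that(1)] inner_on_nonneg[of "Suc m" \<phi>] that(2) by linarith
    then show ?thesis unfolding N_inner[OF that(1), symmetric] by (simp del: fact_Suc)
  qed
  have normalize: "(\<lambda>xs. (1 / sqrt (N \<phi>)) * \<phi> xs) \<in> ?K"
    if "\<phi> \<in> cochains_on (Suc m)" "\<phi> \<noteq> (\<lambda>_. 0)" for \<phi>
  proof -
    have "(\<lambda>xs. (1 / sqrt (N \<phi>)) * \<phi> xs) \<in> cochains_on (Suc m)"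
      using cochains_on_lincomb[OF that(1,1), of "1 / sqrt (N \<phi>)" 0] by simp
    moreover have "N (\<lambda>xs. (1 / sqrt (N \<phi>)) * \<phi> xs) = 1"
      unfolding N_scale using N_pos[OF that] by (simp add: power_divide)
    ultimately show ?thesis by simp
  qed
  obtain \<phi>\<^sub>1 where "\<phi>\<^sub>1 \<in> cochains_on (Suc m)" "\<phi>\<^sub>1 \<noteq> (\<lambda>_. 0)"
    using ex_nonzero_cochain[of "Suc m"] assms by auto
  from normalize[OF this] have "?K \<noteq> {}" by blast
  moreover have "compact ?K"
    unfolding N_def by (rule compact_unit_cochains)
  moreover have "continuous_on ?K E"
    unfolding E_def N_def del_sum_eq by (intro continuous_intros) auto
  ultimately obtain \<phi> where \<phi>: "\<phi> \<in> ?K" and min: "\<forall>\<psi>\<in>?K. E \<phi> \<le> E \<psi>"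
    using continuous_attains_inf by blast
  have coch: "\<phi> \<in> cochains_on (Suc m)" and N1: "N \<phi> = 1"
    using \<phi> by simp_all
  have fact_pos: "fact (Suc m) > (0 :: real)" by (rule fact_gt_zero)
  show ?thesis
  proof (rule that[of \<phi> "E \<phi>"])
    show "\<phi> \<noteq> (\<lambda>_. 0)" using N1 by (auto simp: N_def)
    have "fact (Suc m) * inner_on (Suc m) \<phi> (laplacian m \<phi>) =
        fact (Suc m) * (E \<phi> * inner_on (Suc m) \<phi> \<phi>)"
      using E_inner[OF coch] N_inner[OF coch] N1 by (simp del: fact_Suc add: mult.left_commute)
    then show "inner_on (Suc m) \<phi> (laplacian m \<phi>) = E \<phi> * inner_on (Suc m) \<phi> \<phi>"
      using fact_pos by (simp del: fact_Suc)
  next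
    fix \<psi> assume \<psi>: "\<psi> \<in> cochains_on (Suc m)"
    have "E \<phi> * N \<psi> \<le> E \<psi>"
    proof (cases "\<psi> = (\<lambda>_. 0)")
      case True
      then show ?thesis by (simp add: E_def N_def del_sum_eq)
    next
      case False
      have "E \<phi> \<le> (1 / sqrt (N \<psi>))\<^sup>2 * E \<psi>"
        using min normalize[OF \<psi> False] unfolding E_scale[symmetric] by blast
      then show ?thesis using N_pos[OF \<psi> False] by (simp add: power_divide field_simps)
    qed
    then have "fact (Suc m) * (E \<phi> * inner_on (Suc m) \<psi> \<psi>) \<le>
        fact (Suc m) * inner_on (Suc m) \<psi> (laplacian m \<psi>)"
      unfolding E_inner[OF \<psi>] N_inner[OF \<psi>, symmetric] by (simp only: mult_ac)
    then show "E \<phi> * inner_on (Suc m) \<psi> \<psi> \<le> inner_on (Suc m) \<psi> (laplacian m \<psi>)"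
      using fact_pos by (simp del: fact_Suc)
  qed (rule coch)
qed

lemma inner_laplacian_commute:
  assumes "\<phi> \<in> cochains_on (Suc m)" and "\<psi> \<in> cochains_on (Suc m)"
  shows "inner_on (Suc m) \<psi> (laplacian m \<phi>) = inner_on (Suc m) \<phi> (laplacian m \<psi>)"
  unfolding inner_laplacian[OF assms] inner_laplacian[OF assms(2,1)]
  by (simp only: inner_on_commute)

text \<open>
  The form \<open>B\<close> below is symmetric and positive semidefinite, and \<open>\<phi>\<close> is isotropic for it. Perturbing
  \<open>\<phi>\<close> to \<open>\<phi> + t \<psi>\<close> shows that \<open>\<phi>\<close> is \<open>B\<close>-orthogonal to every cochain \<open>\<psi>\<close>; for
  \<open>\<psi> = L \<phi> - l \<phi>\<close> this says that \<open>\<psi>\<close> has norm zero.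
\<close>
lemma rayleigh_minimizer_eigenvector:
  assumes \<phi>: "\<phi> \<in> cochains_on (Suc m)"
    and eq: "inner_on (Suc m) \<phi> (laplacian m \<phi>) = l * inner_on (Suc m) \<phi> \<phi>"
    and le: "\<And>\<psi>. \<psi> \<in> cochains_on (Suc m) \<Longrightarrow>
               l * inner_on (Suc m) \<psi> \<psi> \<le> inner_on (Suc m) \<psi> (laplacian m \<psi>)"
  shows "laplacian m \<phi> = (\<lambda>xs. l * \<phi> xs)"
proof -
  let ?i = "inner_on (Suc m)" and ?L = "laplacian m"
  define B where "B \<psi> \<theta> = ?i \<psi> (?L \<theta>) - l * ?i \<psi> \<theta>" for \<psi> \<theta>
  have B_commute: "B \<psi> \<theta> = B \<theta> \<psi>"
    if "\<psi> \<in> cochains_on (Suc m)" "\<theta> \<in> cochains_on (Suc m)" for \<psi> \<theta>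
    unfolding B_def inner_laplacian_commute[OF that(2,1)] inner_on_commute[of _ \<psi> \<theta>] ..
  have B_lincomb: "B (\<lambda>xs. 1 * \<phi> xs + t * \<psi> xs) \<theta> = B \<phi> \<theta> + t * B \<psi> \<theta>" for \<psi> \<theta> t
    unfolding B_def inner_on_lincomb_left by (simp add: algebra_simps)
  have B_zero: "B \<psi> \<phi> = 0" if \<psi>: "\<psi> \<in> cochains_on (Suc m)" for \<psi>
  proof (rule nonneg_quadratic_imp_linear_coeff_zero)
    fix t
    let ?\<theta> = "\<lambda>xs. 1 * \<phi> xs + t * \<psi> xs"
    have \<theta>: "?\<theta> \<in> cochains_on (Suc m)" by (rule cochains_on_lincomb[OF \<phi> \<psi>])
    have "B ?\<theta> ?\<theta> = B \<phi> \<phi> + 2 * t * B \<psi> \<phi> + t\<^sup>2 * B \<psi> \<psi>"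
      unfolding B_lincomb[of t \<psi> ?\<theta>] B_commute[OF \<phi> \<theta>] B_commute[OF \<psi> \<theta>] B_lincomb
        B_commute[OF \<phi> \<psi>]
      by (simp add: algebra_simps power2_eq_square)
    moreover have "B \<phi> \<phi> = 0" using eq by (simp add: B_def)
    moreover have "0 \<le> B ?\<theta> ?\<theta>" using le[OF \<theta>] by (simp add: B_def)
    ultimately show "0 \<le> 2 * t * B \<psi> \<phi> + t\<^sup>2 * B \<psi> \<psi>" by simp
  qed
  let ?\<delta> = "\<lambda>xs. 1 * ?L \<phi> xs + (- l) * \<phi> xs"
  have \<delta>: "?\<delta> \<in> cochains_on (Suc m)"
    by (rule cochains_on_lincomb[OF cochains_on_laplacian[OF \<phi>] \<phi>])
  have "?i ?\<delta> ?\<delta> = B ?\<delta> \<phi>"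
    unfolding B_def inner_on_lincomb by simp
  then have "?i ?\<delta> ?\<delta> = 0" using B_zero[OF \<delta>] by simp
  from inner_on_definite[OF \<delta> this] show ?thesis
    by (simp add: fun_eq_iff)
qed

text \<open>
  \<open>LEAST\<close> over the reals is only meaningful if the minimum exists; here it is identified with
  the minimum of the Rayleigh quotient.
\<close>
lemma min_eigenvalue_rayleigh:
  assumes "faces_of_dim X (int m) \<noteq> {}"
  obtains l \<phi> where "min_eigenvalue X (int m) = ereal l"
    and "\<phi> \<in> cochains_on (Suc m)" and "\<phi> \<noteq> (\<lambda>_. 0)"
    and "inner_on (Suc m) \<phi> (laplacian m \<phi>) = l * inner_on (Suc m) \<phi> \<phi>"
    and "\<And>\<psi>. \<psi> \<in> cochains_on (Suc m) \<Longrightarrow>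
           l * inner_on (Suc m) \<psi> \<psi> \<le> inner_on (Suc m) \<psi> (laplacian m \<psi>)"
proof -
  obtain l \<phi> where \<phi>: "\<phi> \<in> cochains_on (Suc m)" "\<phi> \<noteq> (\<lambda>_. 0)"
    and eq: "inner_on (Suc m) \<phi> (laplacian m \<phi>) = l * inner_on (Suc m) \<phi> \<phi>"
    and le: "\<And>\<psi>. \<psi> \<in> cochains_on (Suc m) \<Longrightarrow>
               l * inner_on (Suc m) \<psi> \<psi> \<le> inner_on (Suc m) \<psi> (laplacian m \<psi>)"
    using rayleigh_quotient_attains_min[OF assms] by blast
  have "(LEAST l. laplacian_eigenvalue X (int m) l) = l"
  proof (rule Least_equality)
    show "laplacian_eigenvalue X (int m) l"
      unfolding laplacian_eigenvalue_def
      using \<phi> rayleigh_minimizer_eigenvector[OF \<phi>(1) eq le] by auto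
  next
    fix l' assume "laplacian_eigenvalue X (int m) l'"
    then obtain \<psi> where \<psi>: "\<psi> \<in> cochains_on (Suc m)" "\<psi> \<noteq> (\<lambda>_. 0)"
      and eig: "laplacian m \<psi> = (\<lambda>xs. l' * \<psi> xs)"
      unfolding laplacian_eigenvalue_def by auto
    have "inner_on (Suc m) \<psi> (laplacian m \<psi>) = l' * inner_on (Suc m) \<psi> \<psi>"
      unfolding eig using inner_on_lincomb[of "Suc m" \<psi> l' \<psi> 0 \<psi>] by simp
    then have "l * inner_on (Suc m) \<psi> \<psi> \<le> l' * inner_on (Suc m) \<psi> \<psi>"
      using le[OF \<psi>(1)] by simp
    moreover have "inner_on (Suc m) \<psi> \<psi> > 0"
      using inner_on_definite[OF \<psi>(1)] inner_on_nonneg[of "Suc m" \<psi>] \<psi>(2) by linarith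
    ultimately show "l \<le> l'" by simp
  qed
  then have "min_eigenvalue X (int m) = ereal l"
    using assms by (simp add: min_eigenvalue_def)
  from that[OF this \<phi> eq le] show ?thesis .
qed

section \<open>Comparing consecutive dimensions\<close>

lemma ex_missing_face_subset:
  assumes "\<sigma> \<subseteq> V" and "\<sigma> \<notin> X"
  obtains \<tau> where "\<tau> \<in> missing_faces V X" and "\<tau> \<subseteq> \<sigma>"
proof -
  let ?A = "{\<tau>. \<tau> \<subseteq> \<sigma> \<and> \<tau> \<notin> X}"
  have "finite ?A" using assms(1) finite_subset[OF _ finite_V] by simp
  from finite_has_minimal2[OF this, of \<sigma>] obtain \<tau>
    where \<tau>: "\<tau> \<subseteq> \<sigma>" "\<tau> \<notin> X" and min: "\<forall>\<rho>\<in>?A. \<rho> \<subseteq> \<tau> \<longrightarrow> \<tau> = \<rho>"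
    using assms(2) by auto
  then have "\<tau> \<in> missing_faces V X"
    using assms(1) unfolding missing_faces_def by blast
  with \<tau>(1) show ?thesis using that by blast
qed

text \<open>
  A non-face contains a missing face \<open>\<tau>\<close>, and deleting a vertex outside \<open>\<tau>\<close> leaves a set that still
  contains \<open>\<tau>\<close>. So at most \<open>card \<tau> \<le> d + 1\<close> deletions can lead to a face. This is the only place where
  the bound on the dimension of missing faces enters.
\<close>
lemma non_face_deletions_lower_bound:
  assumes "\<And>\<tau>. \<tau> \<in> missing_faces V X \<Longrightarrow> face_dim \<tau> \<le> d"
    and "distinct xs" and "set xs \<subseteq> V" and "set xs \<notin> X"
  shows "of_int (int (length xs) - d - 1) \<le> del_sum 1 non_face xs"
proof -
  obtain \<tau> where \<tau>: "\<tau> \<in> missing_faces V X" "\<tau> \<subseteq> set xs"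
    using ex_missing_face_subset[OF assms(3,4)] by blast
  have "(if xs ! i \<notin> \<tau> then 1 else 0) \<le> non_face (take i xs @ drop (Suc i) xs)" if "i < length xs" for i
  proof (cases "xs ! i \<in> \<tau>")
    case False
    have "set xs = insert (xs ! i) (set (take i xs @ drop (Suc i) xs))"
      by (subst id_take_nth_drop[OF that]) simp
    then have "\<tau> \<subseteq> set (take i xs @ drop (Suc i) xs)" using \<tau>(2) False by auto
    moreover have "\<tau> \<notin> X" using \<tau>(1) by (simp add: missing_faces_def)
    ultimately have "set (take i xs @ drop (Suc i) xs) \<notin> X" using face_mono by blast
    then show ?thesis by (simp add: non_face_def)
  qed (simp add: non_face_def)
  then have "(\<Sum>i<length xs. if xs ! i \<notin> \<tau> then 1 else 0) \<le> del_sum 1 non_face xs"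
    unfolding del_sum_eq by (intro sum_mono) simp
  moreover have "(\<Sum>i<length xs. if xs ! i \<notin> \<tau> then 1 else (0::real)) = 
      (\<Sum>x\<in>set xs. if x \<notin> \<tau> then 1 else 0)"
    by (rule sum.reindex_bij_betw[OF bij_betw_nth[OF assms(2) refl refl]])
  moreover have "(\<Sum>x\<in>set xs. if x \<notin> \<tau> then 1 else (0::real)) = real (card (set xs - \<tau>))"
    by (simp add: sum.If_cases set_diff_eq Int_def)
  moreover have "real (card (set xs - \<tau>)) = real (length xs) - real (card \<tau>)"
    using \<tau>(2) distinct_card[OF assms(2)] card_mono[OF _ \<tau>(2)]
    by (simp add: card_Diff_subset finite_subset of_nat_diff)
  moreover have "int (card \<tau>) \<le> d + 1"
    using assms(1)[OF \<tau>(1)] by (simp add: face_dim_def)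
  ultimately show ?thesis by linarith
qed

text \<open>
  On the right every non-face of length \<open>m + 1\<close> is counted, by symmetrization, once for each deletion
  that leaves a non-face; by the previous lemma there are at least \<open>m - d\<close> of them. If instead
  \<open>xs\<close> spans a face, then its term on the left vanishes and the one on the right is nonnegative;
  on lists with repeated entries \<open>\<psi>\<close> is zero.
\<close>
lemma non_face_energy_bound:
  assumes "\<And>\<tau>. \<tau> \<in> missing_faces V X \<Longrightarrow> face_dim \<tau> \<le> d"
    and "alternating \<psi>"
  shows "of_int (int m - d) * (\<Sum>xs\<in>words V (Suc m). non_face xs * (\<psi> xs)\<^sup>2) \<le>
         real (Suc m) * (\<Sum>xs\<in>words V (Suc m). non_face (tl xs) * (\<psi> xs)\<^sup>2)"
proof -
  have "swap_scales 1 (\<lambda>xs. (\<psi> xs)\<^sup>2)"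
    unfolding swap_scales_def
  proof (intro allI)
    fix as bs :: "'a list" and x y
    show "(\<psi> (as @ x # y # bs))\<^sup>2 = 1 * (\<psi> (as @ y # x # bs))\<^sup>2"
      using swap_scalesD[OF assms(2), of as x y bs] by simp
  qed
  from sum_mult_del_sum[OF this, where V = V and m = m and \<theta> = non_face]
  have "real (Suc m) * (\<Sum>xs\<in>words V (Suc m). non_face (tl xs) * (\<psi> xs)\<^sup>2) =
      (\<Sum>xs\<in>words V (Suc m). (\<psi> xs)\<^sup>2 * del_sum 1 non_face xs)"
    by (simp add: mult.commute)
  moreover have "of_int (int m - d) * (non_face xs * (\<psi> xs)\<^sup>2) \<le> (\<psi> xs)\<^sup>2 * del_sum 1 non_face xs"
    if xs: "xs \<in> words V (Suc m)" for xs
  proof -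
    have "0 \<le> del_sum 1 non_face xs"
      by (simp add: del_sum_eq non_face_def sum_nonneg)
    moreover have "of_int (int m - d) \<le> del_sum 1 non_face xs" if "distinct xs" "set xs \<notin> X"
      using non_face_deletions_lower_bound[OF assms(1) that(1) _ that(2)] xs by (simp add: words_def)
    moreover have "\<psi> xs = 0" if "\<not> distinct xs"
      by (rule alternating_not_distinct[OF assms(2) that])
    ultimately show ?thesis
      by (cases "distinct xs"; cases "set xs \<in> X")
        (auto simp: non_face_def mult.commute intro: mult_right_mono)
  qed
  ultimately show ?thesis
    unfolding sum_distrib_left by (simp add: sum_mono)
qed

text \<open>
  By Cartan's formula, the coboundary of the slice \<open>\<phi> (u # _)\<close> at \<open>xs\<close> is \<open>\<phi> xs - cob \<phi> (u # xs)\<close>, and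
  \<open>\<phi> xs = 0\<close> if \<open>xs\<close> is a non-face. Thus the non-face terms of all slices together form
  a sum over lists \<open>u # xs\<close> whose tail is a non-face.
\<close>
lemma slices_energy:
  assumes "\<phi> \<in> cochains_on (Suc (Suc m))"
  shows "(\<Sum>u\<in>V. fact (Suc m) * inner_on (Suc m) (\<lambda>ys. \<phi> (u # ys)) (laplacian m (\<lambda>ys. \<phi> (u # ys)))) =
    real (card V) * (\<Sum>xs\<in>words V (m + 2). (\<phi> xs)\<^sup>2)
      - (\<Sum>xs\<in>words V (m + 3). non_face (tl xs) * (cob \<phi> xs)\<^sup>2) / real (m + 2)"
proof -
  have "non_face xs * (cob (\<lambda>ys. \<phi> (u # ys)) xs)\<^sup>2 = non_face xs * (cob \<phi> (u # xs))\<^sup>2" for u xs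
  proof (cases "distinct xs \<and> set xs \<in> X")
    case False
    then have "\<phi> xs = 0"
      by (intro cochains_on_zero[OF assms]) (auto simp: face_words_def)
    then show ?thesis by simp
  qed (simp add: non_face_def)
  then have "(\<Sum>u\<in>V. \<Sum>xs\<in>words V (Suc (Suc m)). non_face xs * (cob (\<lambda>ys. \<phi> (u # ys)) xs)\<^sup>2) =
      (\<Sum>xs\<in>words V (Suc (Suc (Suc m))). non_face (tl xs) * (cob \<phi> xs)\<^sup>2)"
    unfolding sum_words_Suc[of _ _ "Suc (Suc m)"] list.sel by (intro sum.cong refl)
  then show ?thesis
    unfolding laplacian_energy[OF cochains_on_slice[OF assms]] 
    by (simp add: sum_subtractf sum_words_Suc[of _ _ "Suc m"] sum_distrib_left[symmetric]
        sum_divide_distrib[symmetric] numeral_3_eq_3)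
qed

text \<open>
  The slices of \<open>\<phi>\<close> serve as test cochains for the Rayleigh quotient one dimension lower. With \<open>N\<close> the
  squared norm of \<open>\<phi>\<close>, \<open>S\<close> its non-face energy and \<open>T\<close> the part of it that survives in the slices, all
  taken as sums over lists, the three relations combined are
  \<open>l' N \<le> n N - T / (m + 2)\<close>, \<open>l N = n N - S / (m + 3)\<close> and \<open>(m + 2 - d) S \<le> (m + 3) T\<close>.
\<close>
lemma min_eigenvalue_step:
  assumes bound: "\<And>\<tau>. \<tau> \<in> missing_faces V X \<Longrightarrow> face_dim \<tau> \<le> d"
    and \<phi>: "\<phi> \<in> cochains_on (Suc (Suc m))" "\<phi> \<noteq> (\<lambda>_. 0)"
    and eq: "inner_on (Suc (Suc m)) \<phi> (laplacian (Suc m) \<phi>) = l * inner_on (Suc (Suc m)) \<phi> \<phi>"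
    and le: "\<And>\<psi>. \<psi> \<in> cochains_on (Suc m) \<Longrightarrow>
               l' * inner_on (Suc m) \<psi> \<psi> \<le> inner_on (Suc m) \<psi> (laplacian m \<psi>)"
  shows "real (m + 2) * l' - of_int d * real (card V) \<le> of_int (int (m + 2) - d) * l"
proof -
  let ?n = "real (card V)" and ?K = "of_int (int (m + 2) - d) :: real"
  define N where "N = (\<Sum>xs\<in>words V (m + 2). (\<phi> xs)\<^sup>2)"
  define S where "S = (\<Sum>xs\<in>words V (m + 3). non_face xs * (cob \<phi> xs)\<^sup>2)"
  define T where "T = (\<Sum>xs\<in>words V (m + 3). non_face (tl xs) * (cob \<phi> xs)\<^sup>2)"
  have N_inner: "fact (Suc (Suc m)) * inner_on (Suc (Suc m)) \<phi> \<phi> = N"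
    using inner_on_words[OF \<phi>(1,1)] by (simp add: N_def power2_eq_square del: fact_Suc)
  have "inner_on (Suc (Suc m)) \<phi> \<phi> > 0"
    using inner_on_definite[OF \<phi>(1)] inner_on_nonneg[of "Suc (Suc m)" \<phi>] \<phi>(2) by linarith
  then have N_pos: "N > 0" unfolding N_inner[symmetric] by (simp del: fact_Suc)
  have "l' * N = (\<Sum>u\<in>V. fact (Suc m) * (l' * inner_on (Suc m) (\<lambda>ys. \<phi> (u # ys)) (\<lambda>ys. \<phi> (u # ys))))"
  proof -
    have "fact (Suc m) * (l' * inner_on (Suc m) (\<lambda>ys. \<phi> (u # ys)) (\<lambda>ys. \<phi> (u # ys))) =
        l' * (\<Sum>ys\<in>words V (Suc m). (\<phi> (u # ys))\<^sup>2)" for u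
      using inner_on_words[OF cochains_on_slice[OF \<phi>(1)] cochains_on_slice[OF \<phi>(1)], of u u]
      by (simp only: power2_eq_square mult.left_commute[of "fact (Suc m)"])
    then show ?thesis
      by (simp add: N_def sum_words_Suc[of _ _ "Suc m"] sum_distrib_left del: fact_Suc)
  qed
  also have "\<dots> \<le> (\<Sum>u\<in>V. fact (Suc m) * inner_on (Suc m) (\<lambda>ys. \<phi> (u # ys)) (laplacian m (\<lambda>ys. \<phi> (u # ys))))"
    by (intro sum_mono mult_left_mono le cochains_on_slice \<phi>(1)) simp
  also have "\<dots> = ?n * N - T / real (m + 2)"
    unfolding N_def T_def by (rule slices_energy[OF \<phi>(1)])
  finally have lower: "real (m + 2) * (l' * N) \<le> real (m + 2) * (?n * N) - T"
    by (simp add: field_simps)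
  have "fact (Suc (Suc m)) * inner_on (Suc (Suc m)) \<phi> (laplacian (Suc m) \<phi>) = ?n * N - S / real (m + 3)"
    using laplacian_energy[OF \<phi>(1)] by (simp add: N_def S_def numeral_3_eq_3 del: fact_Suc)
  then have "l * N = ?n * N - S / real (m + 3)"
    unfolding eq N_inner[symmetric] by (simp only: mult.left_commute[of "fact (Suc (Suc m))"])
  then have "S = real (m + 3) * ((?n - l) * N)"
    by (simp add: field_simps)
  then have "?K * S = real (m + 3) * (?K * ((?n - l) * N))"
    by (simp only: mult.left_commute)
  moreover have "?K * S \<le> real (m + 3) * T"
    using non_face_energy_bound[OF bound alternating_cob[OF cochains_on_alternating[OF \<phi>(1)]], where m = "m + 2"]
    unfolding S_def T_def by (simp add: numeral_3_eq_3)
  ultimately have "real (m + 3) * (?K * ((?n - l) * N)) \<le> real (m + 3) * T" by linarith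
  then have "?K * ((?n - l) * N) \<le> T"
    by (rule mult_left_le_imp_le) simp
  with lower have "real (m + 2) * (l' * N) \<le> real (m + 2) * (?n * N) - ?K * ((?n - l) * N)" by simp
  then have "(real (m + 2) * l' - of_int d * ?n) * N \<le> (?K * l) * N"
    by (simp add: algebra_simps)
  then show ?thesis using N_pos by simp
qed

lemma faces_of_dim_lower:
  assumes "faces_of_dim X (int (Suc m)) \<noteq> {}"
  shows "faces_of_dim X (int m) \<noteq> {}"
proof -
  obtain \<sigma> where \<sigma>: "\<sigma> \<in> X" "card \<sigma> = Suc (Suc m)"
    using assms by (auto simp: faces_of_dim_def face_dim_def)
  then obtain v where "v \<in> \<sigma>" by fastforce
  have "\<sigma> - {v} \<in> X" by (rule face_mono[OF \<sigma>(1)]) blast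
  moreover have "card (\<sigma> - {v}) = Suc m" using \<sigma>(2) \<open>v \<in> \<sigma>\<close> by simp
  ultimately have "\<sigma> - {v} \<in> faces_of_dim X (int m)" by (simp add: faces_of_dim_def face_dim_def)
  then show ?thesis by blast
qed

lemma missing_face_dim_le_max:
  assumes "\<tau> \<in> missing_faces V X"
  shows "face_dim \<tau> \<le> max_missing_dim V X"
proof -
  have "finite (missing_faces V X)"
    by (rule finite_subset[of _ "Pow V"]) (auto simp: missing_faces_def)
  then show ?thesis unfolding max_missing_dim_def using assms by (intro Max_ge) simp_all
qed

lemma missing_face_dim_pos:
  assumes "\<tau> \<in> missing_faces V X"
  shows "1 \<le> face_dim \<tau>"
proof -
  have \<tau>: "\<tau> \<subseteq> V" "\<tau> \<notin> X" using assms by (auto simp: missing_faces_def)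
  then have "finite \<tau>" using finite_subset[OF _ finite_V] by blast
  moreover have "\<tau> \<noteq> {}" and "\<nexists>v. \<tau> = {v}"
    using \<tau> complex by (auto simp: abstract_simplicial_complex_def)
  ultimately have "card \<tau> \<noteq> 0" "card \<tau> \<noteq> 1" by (auto simp: card_1_singleton_iff)
  then show ?thesis by (simp add: face_dim_def)
qed

end

theorem theorem1p2:
  fixes V :: "'a set" and X :: "'a set set" and n :: nat and d k :: int
  assumes "abstract_simplicial_complex V X"
    and "card V = n"
    and "missing_faces V X \<noteq> {}"
    and "max_missing_dim V X = d"
    and "k \<ge> d"
  shows "ereal (of_int (k - d + 1)) * min_eigenvalue X k
           \<ge> ereal (of_int (k + 1)) * min_eigenvalue X (k - 1) - ereal (of_int d * of_nat n)"
proof -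
  interpret finite_complex V X by (rule finite_complex.intro[OF assms(1)])
  have bound: "face_dim \<tau> \<le> d" if "\<tau> \<in> missing_faces V X" for \<tau>
    using missing_face_dim_le_max[OF that] assms(4) by simp
  have "d \<ge> 1" using assms(3) bound missing_face_dim_pos by fastforce
  define m where "m = nat (k - 1)"
  have k: "k = int (Suc m)" and k1: "k - 1 = int m"
    using \<open>d \<ge> 1\<close> assms(5) by (simp_all add: m_def)
  show ?thesis
  proof (cases "faces_of_dim X k = {}")
    case True
    then have "min_eigenvalue X k = \<infinity>" by (simp add: min_eigenvalue_def)
    moreover have "real_of_int (k - d + 1) > 0" using assms(5) by simp
    ultimately show ?thesis by simp
  next
    case False
    then have ne: "faces_of_dim X (int (Suc m)) \<noteq> {}" using k by simp
    obtain l \<phi> where l: "min_eigenvalue X k = ereal l"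
      and \<phi>: "\<phi> \<in> cochains_on (Suc (Suc m))" "\<phi> \<noteq> (\<lambda>_. 0)"
        "inner_on (Suc (Suc m)) \<phi> (laplacian (Suc m) \<phi>) = l * inner_on (Suc (Suc m)) \<phi> \<phi>"
      using min_eigenvalue_rayleigh[OF ne] unfolding k by metis
    obtain l' where l': "min_eigenvalue X (k - 1) = ereal l'"
      and le: "\<And>\<psi>. \<psi> \<in> cochains_on (Suc m) \<Longrightarrow>
        l' * inner_on (Suc m) \<psi> \<psi> \<le> inner_on (Suc m) \<psi> (laplacian m \<psi>)"
      using min_eigenvalue_rayleigh[OF faces_of_dim_lower[OF ne]] unfolding k1 by metis
    have "real (m + 2) * l' - of_int d * real (card V) \<le> of_int (int (m + 2) - d) * l"
      by (rule min_eigenvalue_step[OF bound \<phi> le])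
    moreover have "real (m + 2) = of_int (k + 1)" "int (m + 2) - d = k - d + 1"
      using k by simp_all
    ultimately have "of_int (k + 1) * l' - of_int d * real n \<le> of_int (k - d + 1) * l"
      using assms(2) by (simp only:)
    then show ?thesis unfolding l l' by simp
  qed
qed

end
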